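(* Let $P$ be a poset. The following propositions are equivalent. (i) The order on $P$ is a semiorder. (ii) $P$ is isomorphic to a collection $\mathcal J$ of nonempty intervals of some chain which are pairwise incomparable with respect to inclusion, $\mathcal J$ being ordered by the interval ordering. (iii) There are a totally ordered abelian group $G$ and an element $\alpha>0$ of $G$ such that $P$ is isomorphic to a collection $\mathcal J$ of intervals of $G$, each of the form $[x,x+\alpha[\;=\{y\in G: x\leq y<x+\alpha\}$ with $x\in G$, $\mathcal J$ being ordered by the interval ordering. (iv) $P$ is embeddable into an abelian threshold group with some attained threshold $\alpha$. (v) $P$ is embeddable into a threshold group.
   Context: Groups are written additively. An ordered group is a group (not necessarily abelian) with a partial order compatible with the group operation (preserved by all left and right translations). A poset $P$ embeds into a poset (or ordered group) $P'$ if there is a one-to-one map $f$ with $f(x)\leq f(y)$ if and only if $x\leq y$. For positive integers $r,s$, $r\oplus s$ is the disjoint union of an $r$-element chain and an $s$-element chain with no comparabilities between them. An order is a semiorder if it embeds neither $2\oplus 2$ nor $3\oplus 1$. Interval ordering: for nonempty intervals $I,J$ (convex subsets) of a chain, $I<J$ if $x<y$ for every $x\in I$ and every $y\in J$; and $I\leq J$ if $I=J$ or $I<J$. For an order $\leq$ on $X$ with strict order $<$, set $x\leq_{pred}y$ if for all $z\in X$, $z<x$ implies $z<y$, and $x\leq_{succ}y$ if for all $z\in X$, $y<z$ implies $x<z$. A threshold order is an order for which $\leq_{pred}$ and $\leq_{succ}$ are total orders and are equal; a threshold group is an ordered group whose order is a threshold order. An abelian threshold group with attained threshold $\alpha$ is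 an ordered group $(X,+,\leq_\alpha)$, where $(X,+,\preceq)$ is a totally ordered abelian group, $0\prec\alpha$, and $x\leq_\alpha y$ means $x=y$ or $\alpha\preceq y-x$ (such an ordered group is a threshold group). *)

theory Defs
  imports "HOL-Algebra.Group"
begin

section \<open>Embeddings and isomorphisms of posets\<close>

text \<open>
  A poset is a carrier \<open>A\<close> with a reflexive relation \<open>r\<close> such that \<^term>\<open>partial_order_on A r\<close>.
  The notions \<open>embed\<close> and \<open>iso\<close> of the library require images to be initial segments, which is not
  what is meant by an embedding of posets here.
\<close>

definition poset_embedding ::
  "'a set \<Rightarrow> 'a rel \<Rightarrow> 'b set \<Rightarrow> 'b rel \<Rightarrow> ('a \<Rightarrow> 'b) \<Rightarrow> bool" where
  "poset_embedding A r B s f \<longleftrightarrow>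
     inj_on f A \<and> f ` A \<subseteq> B \<and> (\<forall>x\<in>A. \<forall>y\<in>A. (f x, f y) \<in> s \<longleftrightarrow> (x, y) \<in> r)"

definition poset_embeds :: "'a set \<Rightarrow> 'a rel \<Rightarrow> 'b set \<Rightarrow> 'b rel \<Rightarrow> bool" where
  "poset_embeds A r B s \<longleftrightarrow> (\<exists>f. poset_embedding A r B s f)"

definition poset_isomorphic :: "'a set \<Rightarrow> 'a rel \<Rightarrow> 'b set \<Rightarrow> 'b rel \<Rightarrow> bool" where
  "poset_isomorphic A r B s \<longleftrightarrow> (\<exists>f. poset_embedding A r B s f \<and> f ` A = B)"


section \<open>Semiorders\<close>

definition chain_sum_carrier :: "nat \<Rightarrow> nat \<Rightarrow> (nat + nat) set" where
  "chain_sum_carrier m n = {..<m} <+> {..<n}"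

definition chain_sum_rel :: "nat \<Rightarrow> nat \<Rightarrow> (nat + nat) rel" where
  "chain_sum_rel m n =
     {(Inl i, Inl j) | i j. i \<le> j \<and> j < m} \<union> {(Inr i, Inr j) | i j. i \<le> j \<and> j < n}"

definition semiorder_on :: "'a set \<Rightarrow> 'a rel \<Rightarrow> bool" where
  "semiorder_on A r \<longleftrightarrow>
     partial_order_on A r \<and>
     \<not> poset_embeds (chain_sum_carrier 2 2) (chain_sum_rel 2 2) A r \<and>
     \<not> poset_embeds (chain_sum_carrier 3 1) (chain_sum_rel 3 1) A r"


section \<open>Intervals of a chain\<close>

definition interval_in :: "'c set \<Rightarrow> 'c rel \<Rightarrow> 'c set \<Rightarrow> bool" where
  "interval_in C L I \<longleftrightarrow>
     I \<subseteq> C \<and> (\<forall>x\<in>I. \<forall>y\<in>I. \<forall>z\<in>C. (x, z) \<in> L \<and> (z, y) \<in> L \<longrightarrow> z \<in> I)"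

definition interval_less :: "'c rel \<Rightarrow> 'c set \<Rightarrow> 'c set \<Rightarrow> bool" where
  "interval_less L I J \<longleftrightarrow> (\<forall>x\<in>I. \<forall>y\<in>J. (x, y) \<in> L \<and> x \<noteq> y)"

definition interval_ordering :: "'c rel \<Rightarrow> 'c set set \<Rightarrow> 'c set rel" where
  "interval_ordering L \<J> = {(I, J). I \<in> \<J> \<and> J \<in> \<J> \<and> (I = J \<or> interval_less L I J)}"


section \<open>Ordered groups and threshold groups\<close>

text \<open>
  Groups are those of HOL-Algebra, hence written multiplicatively: \<open>x + y\<close>, \<open>0\<close> and \<open>y - x\<close> become
  \<open>x \<otimes> y\<close>, \<open>\<one>\<close> and \<open>y \<otimes> inv x\<close>.
\<close>

locale ordered_group = group G for G (structure) +
  fixes r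
  assumes partial_order: "partial_order_on (carrier G) r"
    and left_translation:
      "\<lbrakk>x \<in> carrier G; y \<in> carrier G; z \<in> carrier G; (x, y) \<in> r\<rbrakk> \<Longrightarrow> (z \<otimes> x, z \<otimes> y) \<in> r"
    and right_translation:
      "\<lbrakk>x \<in> carrier G; y \<in> carrier G; z \<in> carrier G; (x, y) \<in> r\<rbrakk> \<Longrightarrow> (x \<otimes> z, y \<otimes> z) \<in> r"

locale totally_ordered_abelian_group = ordered_group G r + comm_group G
  for G (structure) and r +
  assumes linear_order: "linear_order_on (carrier G) r"

definition le_pred :: "'a set \<Rightarrow> 'a rel \<Rightarrow> 'a rel" where
  "le_pred X r = {(x, y). x \<in> X \<and> y \<in> X \<and>
     (\<forall>z\<in>X. (z, x) \<in> r \<and> z \<noteq> x \<longrightarrow> (z, y) \<in> r \<and> z \<noteq> y)}"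

definition le_succ :: "'a set \<Rightarrow> 'a rel \<Rightarrow> 'a rel" where
  "le_succ X r = {(x, y). x \<in> X \<and> y \<in> X \<and>
     (\<forall>z\<in>X. (y, z) \<in> r \<and> y \<noteq> z \<longrightarrow> (x, z) \<in> r \<and> x \<noteq> z)}"

definition threshold_order_on :: "'a set \<Rightarrow> 'a rel \<Rightarrow> bool" where
  "threshold_order_on X r \<longleftrightarrow>
     partial_order_on X r \<and> linear_order_on X (le_pred X r) \<and> linear_order_on X (le_succ X r) \<and>
     le_pred X r = le_succ X r"

definition threshold_group :: "'g monoid \<Rightarrow> 'g rel \<Rightarrow> bool" where
  "threshold_group G r \<longleftrightarrow> ordered_group G r \<and> threshold_order_on (carrier G) r"

definition threshold_rel :: "'g monoid \<Rightarrow> 'g rel \<Rightarrow> 'g \<Rightarrow> 'g rel" where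
  "threshold_rel G L \<alpha> = {(x, y). x \<in> carrier G \<and> y \<in> carrier G \<and>
     (x = y \<or> (\<alpha>, y \<otimes>\<^bsub>G\<^esub> inv\<^bsub>G\<^esub> x) \<in> L)}"

definition positive_in :: "'g monoid \<Rightarrow> 'g rel \<Rightarrow> 'g \<Rightarrow> bool" where
  "positive_in G L \<alpha> \<longleftrightarrow> \<alpha> \<in> carrier G \<and> (\<one>\<^bsub>G\<^esub>, \<alpha>) \<in> L \<and> \<alpha> \<noteq> \<one>\<^bsub>G\<^esub>"

definition abelian_threshold_group_attained :: "'g monoid \<Rightarrow> 'g rel \<Rightarrow> 'g \<Rightarrow> bool" where
  "abelian_threshold_group_attained G r \<alpha> \<longleftrightarrow>
     (\<exists>L. totally_ordered_abelian_group G L \<and> positive_in G L \<alpha> \<and> r = threshold_rel G L \<alpha>)"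

definition half_open_interval :: "'g monoid \<Rightarrow> 'g rel \<Rightarrow> 'g \<Rightarrow> 'g \<Rightarrow> 'g set" where
  "half_open_interval G L \<alpha> x =
     {y \<in> carrier G. (x, y) \<in> L \<and> (y, x \<otimes>\<^bsub>G\<^esub> \<alpha>) \<in> L \<and> y \<noteq> x \<otimes>\<^bsub>G\<^esub> \<alpha>}"


section \<open>Representations of a poset\<close>

text \<open>
  Existential quantification over a chain or a group ranges over structures whose carrier is a subset
  of a given type; that type is made explicit as a \<open>TYPE('c)\<close> argument.
\<close>

definition rep_by_incomparable_intervals :: "'c itself \<Rightarrow> 'a set \<Rightarrow> 'a rel \<Rightarrow> bool" where
  "rep_by_incomparable_intervals _ P r \<longleftrightarrow>
     (\<exists>(C :: 'c set) L \<J>.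
        linear_order_on C L \<and>
        (\<forall>I\<in>\<J>. interval_in C L I \<and> I \<noteq> {}) \<and>
        (\<forall>I\<in>\<J>. \<forall>J\<in>\<J>. I \<noteq> J \<longrightarrow> \<not> I \<subseteq> J \<and> \<not> J \<subseteq> I) \<and>
        poset_isomorphic P r \<J> (interval_ordering L \<J>))"

definition rep_by_group_intervals :: "'g itself \<Rightarrow> 'a set \<Rightarrow> 'a rel \<Rightarrow> bool" where
  "rep_by_group_intervals _ P r \<longleftrightarrow>
     (\<exists>(G :: 'g monoid) L \<alpha> \<J>.
        totally_ordered_abelian_group G L \<and> positive_in G L \<alpha> \<and>
        (\<forall>J\<in>\<J>. \<exists>x\<in>carrier G. J = half_open_interval G L \<alpha> x) \<and>
        poset_isomorphic P r \<J> (interval_ordering L \<J>))"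

definition embeds_in_attained_threshold_group :: "'g itself \<Rightarrow> 'a set \<Rightarrow> 'a rel \<Rightarrow> bool" where
  "embeds_in_attained_threshold_group _ P r \<longleftrightarrow>
     (\<exists>(G :: 'g monoid) s \<alpha>.
        abelian_threshold_group_attained G s \<alpha> \<and> poset_embeds P r (carrier G) s)"

definition embeds_in_threshold_group :: "'g itself \<Rightarrow> 'a set \<Rightarrow> 'a rel \<Rightarrow> bool" where
  "embeds_in_threshold_group _ P r \<longleftrightarrow>
     (\<exists>(G :: 'g monoid) s. threshold_group G s \<and> poset_embeds P r (carrier G) s)"

text \<open>
  A type large enough to realise all the existence claims for a poset on \<open>'a\<close>: it contains the free
  abelian group on the elements of the poset together with one further generator for the threshold.
\<close>

type_synonym 'a rep_universe = "'a option \<Rightarrow> int"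

end

theory Submission
  imports Defs "HOL-Library.Function_Algebras" "HOL-Library.Multiset"
begin

text \<open>
  The implications are (i) to (iv) to (iii) to (ii) to (i), and (iv) to (v) to (i). Those ending in (i) become short
  once the two forbidden posets are read as exchange conditions on the strict order: \<open>a < b\<close> and \<open>c < d\<close> imply
  \<open>a < d\<close> or \<open>c < b\<close>, and \<open>a < b < c\<close> implies \<open>a < d\<close> or \<open>d < c\<close> for every \<open>d\<close> (\<open>semiorder_on_iff_exchange\<close>).
  These conditions pass to suborders, and they hold for incomparable intervals and for threshold orders.

  The substance is the passage from (i) to (iv), for a poset of any cardinality. In the group of
  integer-valued functions, let the elements of \<open>P\<close> and one more symbol \<open>\<alpha>\<close> be represented by distinct unit
  vectors. A total order on this group is wanted in which \<open>\<alpha>\<close> is positive, \<open>y - x - \<alpha>\<close> is positive if \<open>x < y\<close>, and \<open>x - y + \<alpha>\<close> is positive otherwise. In a torsion-free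
  abelian group, prescribed elements are positive for some total order as soon as no nonempty sum of them vanishes;
  this is an application of Zorn's lemma (\<open>extend_to_total_cone\<close>).

  To exclude vanishing sums, read \<open>y - x + n \<alpha>\<close> as an edge from \<open>x\<close> to \<open>y\<close> of weight \<open>n\<close>. In a vanishing
  sum every edge that is not a loop is followed by another one, so consecutive edges can be merged until only
  loops remain (\<open>edge_sum_nonzero\<close>); it suffices that closed walks have positive weight. Here the semiorder enters. It has
  a compatible linear order \<open>T\<close> (\<open>linear_refinement\<close>), whose pairs serve as edges of weight \<open>0\<close>. From \<open>x < y\<close>
  and not \<open>z < y\<close> it follows that \<open>x\<close> precedes \<open>z\<close> in \<open>T\<close>: an edge of weight \<open>-1\<close> cancels against one of weight
  \<open>1\<close>, in either order, and leaves an edge of weight \<open>0\<close>. Thus every walk reduces to one whose edges have a single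
  sign (\<open>weighted_walk_compose\<close>), and a closed walk of weight at most \<open>0\<close> would increase strictly in \<open>T\<close>
  (\<open>weighted_walk_loop\<close>).
\<close>


section \<open>Semiorders by exchange conditions\<close>

text \<open>
  Here \<open>A\<close> is a strict order. Among \<open>a < b\<close> and \<open>c < d\<close> with neither \<open>a < d\<close> nor \<open>c < b\<close> the four points
  form a copy of \<open>2 \<oplus> 2\<close>; a point \<open>d\<close> with neither \<open>a < d\<close> nor \<open>d < c\<close> is incomparable to the whole
  chain \<open>a < b < c\<close>, which gives \<open>3 \<oplus> 1\<close>.
\<close>

definition semiorder_exchange :: "'a set \<Rightarrow> 'a rel \<Rightarrow> bool" where
  "semiorder_exchange P A \<longleftrightarrow>
     (\<forall>a b c d. (a, b) \<in> A \<longrightarrow> (c, d) \<in> A \<longrightarrow> (a, d) \<in> A \<or> (c, b) \<in> A) \<and>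
     (\<forall>a b c d. (a, b) \<in> A \<longrightarrow> (b, c) \<in> A \<longrightarrow> d \<in> P \<longrightarrow> (a, d) \<in> A \<or> (d, c) \<in> A)"

lemma semiorder_on_iff_exchange:
  fixes A :: "'a set"
  assumes po: "partial_order_on A r"
  shows "semiorder_on A r \<longleftrightarrow> semiorder_exchange A (r - Id)"
proof
  have sub: "r \<subseteq> A \<times> A" and refl: "\<And>x. x \<in> A \<Longrightarrow> (x, x) \<in> r" and tr: "trans r" and anti: "antisym r"
    using po by (auto simp: order_on_defs refl_on_def)
  assume semi: "semiorder_on A r"
  have "(a, d) \<in> r - Id \<or> (c, b) \<in> r - Id" if ab: "(a, b) \<in> r - Id" and cd: "(c, d) \<in> r - Id" for a b c d
  proof (rule ccontr)
    assume no: "\<not> ?thesis"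
    (* The four points form a forbidden copy of 2 + 2. *)
    define f :: "nat + nat \<Rightarrow> 'a" where
      "f = case_sum (\<lambda>i. if i = 0 then a else b) (\<lambda>i. if i = 0 then c else d)"
    have in_A: "a \<in> A" "b \<in> A" "c \<in> A" "d \<in> A" using ab cd sub by auto
    have incomparable: "(a, c) \<notin> r" "(a, d) \<notin> r" "(b, c) \<notin> r" "(b, d) \<notin> r"
      "(c, a) \<notin> r" "(c, b) \<notin> r" "(d, a) \<notin> r" "(d, b) \<notin> r" "(b, a) \<notin> r" "(d, c) \<notin> r"
      using ab cd no tr anti by (auto dest: transD antisymD)
    have "poset_embedding (chain_sum_carrier 2 2) (chain_sum_rel 2 2) A r f"
      unfolding poset_embedding_def
    proof (intro conjI)
      show "inj_on f (chain_sum_carrier 2 2)"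
        using ab cd incomparable refl in_A
        by (auto simp: f_def inj_on_def chain_sum_carrier_def less_2_cases_iff)
      show "f ` chain_sum_carrier 2 2 \<subseteq> A"
        using in_A by (auto simp: f_def chain_sum_carrier_def less_2_cases_iff)
      show "\<forall>x\<in>chain_sum_carrier 2 2. \<forall>y\<in>chain_sum_carrier 2 2.
          (f x, f y) \<in> r \<longleftrightarrow> (x, y) \<in> chain_sum_rel 2 2"
        using ab cd incomparable refl in_A
        by (auto simp: f_def chain_sum_carrier_def chain_sum_rel_def less_2_cases_iff)
    qed
    then show False using semi unfolding semiorder_on_def poset_embeds_def by blast
  qed
  moreover have "(a, d) \<in> r - Id \<or> (d, c) \<in> r - Id"
    if ab: "(a, b) \<in> r - Id" and bc: "(b, c) \<in> r - Id" and d: "d \<in> A" for a b c d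
  proof (rule ccontr)
    assume no: "\<not> ?thesis"
    (* The three points of the chain and d form a forbidden copy of 3 + 1. *)
    define f :: "nat + nat \<Rightarrow> 'a" where
      "f = case_sum (\<lambda>i. if i = 0 then a else if i = 1 then b else c) (\<lambda>i. d)"
    have in_A: "a \<in> A" "b \<in> A" "c \<in> A" "d \<in> A" using ab bc d sub by auto
    have chain: "(a, c) \<in> r" "(c, a) \<notin> r" "(b, a) \<notin> r" "(c, b) \<notin> r"
      using ab bc tr anti by (auto dest: transD antisymD)
    have incomparable: "(a, d) \<notin> r" "(b, d) \<notin> r" "(c, d) \<notin> r"
      "(d, a) \<notin> r" "(d, b) \<notin> r" "(d, c) \<notin> r"
      using ab bc no tr anti chain by (auto dest: transD antisymD)
    have "poset_embedding (chain_sum_carrier 3 1) (chain_sum_rel 3 1) A r f"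
      unfolding poset_embedding_def
    proof (intro conjI)
      show "inj_on f (chain_sum_carrier 3 1)"
        using ab bc incomparable chain refl in_A
        by (auto simp: f_def inj_on_def chain_sum_carrier_def numeral_3_eq_3 less_Suc_eq)
      show "f ` chain_sum_carrier 3 1 \<subseteq> A"
        using in_A by (auto simp: f_def chain_sum_carrier_def)
      show "\<forall>x\<in>chain_sum_carrier 3 1. \<forall>y\<in>chain_sum_carrier 3 1.
          (f x, f y) \<in> r \<longleftrightarrow> (x, y) \<in> chain_sum_rel 3 1"
        using ab bc incomparable chain refl in_A
        by (auto simp: f_def chain_sum_carrier_def chain_sum_rel_def numeral_3_eq_3 less_Suc_eq)
    qed
    then show False using semi unfolding semiorder_on_def poset_embeds_def by blast
  qed
  ultimately show "semiorder_exchange A (r - Id)"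
    unfolding semiorder_exchange_def by blast
next
  assume exchange: "semiorder_exchange A (r - Id)"
  have "\<not> poset_embedding (chain_sum_carrier 2 2) (chain_sum_rel 2 2) A r f" for f
  proof
    assume "poset_embedding (chain_sum_carrier 2 2) (chain_sum_rel 2 2) A r f"
    then have f: "(f x, f y) \<in> r - Id \<longleftrightarrow> (x, y) \<in> chain_sum_rel 2 2 \<and> x \<noteq> y"
      if "x \<in> chain_sum_carrier 2 2" "y \<in> chain_sum_carrier 2 2" for x y
      using that by (auto simp: poset_embedding_def inj_on_def)
    have "(f (Inl 0), f (Inl 1)) \<in> r - Id" "(f (Inr 0), f (Inr 1)) \<in> r - Id"
      "(f (Inl 0), f (Inr 1)) \<notin> r - Id" "(f (Inr 0), f (Inl 1)) \<notin> r - Id"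
      by (subst f; auto simp: chain_sum_carrier_def chain_sum_rel_def)+
    then show False using exchange unfolding semiorder_exchange_def by blast
  qed
  moreover have "\<not> poset_embedding (chain_sum_carrier 3 1) (chain_sum_rel 3 1) A r f" for f
  proof
    assume emb: "poset_embedding (chain_sum_carrier 3 1) (chain_sum_rel 3 1) A r f"
    then have f: "(f x, f y) \<in> r - Id \<longleftrightarrow> (x, y) \<in> chain_sum_rel 3 1 \<and> x \<noteq> y"
      if "x \<in> chain_sum_carrier 3 1" "y \<in> chain_sum_carrier 3 1" for x y
      using that by (auto simp: poset_embedding_def inj_on_def)
    have "(f (Inl 0), f (Inl 1)) \<in> r - Id" "(f (Inl 1), f (Inl 2)) \<in> r - Id"
      "(f (Inl 0), f (Inr 0)) \<notin> r - Id" "(f (Inr 0), f (Inl 2)) \<notin> r - Id"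
      by (subst f; auto simp: chain_sum_carrier_def chain_sum_rel_def)+
    moreover have "f (Inr 0) \<in> A" using emb by (auto simp: poset_embedding_def chain_sum_carrier_def)
    ultimately show False using exchange unfolding semiorder_exchange_def by blast
  qed
  ultimately show "semiorder_on A r"
    using po unfolding semiorder_on_def poset_embeds_def by blast
qed

lemma semiorder_exchange_embedding:
  assumes "poset_embedding P r B s f" "r \<subseteq> P \<times> P" "semiorder_exchange B (s - Id)"
  shows "semiorder_exchange P (r - Id)"
proof -
  have f: "(f x, f y) \<in> s - Id \<longleftrightarrow> (x, y) \<in> r - Id" if "x \<in> P" "y \<in> P" for x y
    using assms(1) that by (auto simp: poset_embedding_def inj_on_def)
  have range: "f x \<in> B" if "x \<in> P" for x using assms(1) that by (auto simp: poset_embedding_def)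
  have sub: "x \<in> P \<and> y \<in> P" if "(x, y) \<in> r - Id" for x y using assms(2) that by blast
  show ?thesis
    unfolding semiorder_exchange_def
  proof (intro conjI allI impI)
    fix a b c d assume ab: "(a, b) \<in> r - Id"
    show "(a, d) \<in> r - Id \<or> (c, b) \<in> r - Id" if cd: "(c, d) \<in> r - Id"
    proof -
      have P: "a \<in> P" "b \<in> P" "c \<in> P" "d \<in> P" using sub[OF ab] sub[OF cd] by auto
      then have "(f a, f b) \<in> s - Id" "(f c, f d) \<in> s - Id" using f ab cd by blast+
      then have "(f a, f d) \<in> s - Id \<or> (f c, f b) \<in> s - Id"
        using assms(3) unfolding semiorder_exchange_def by blast
      then show ?thesis using f P by blast
    qed
    show "(a, d) \<in> r - Id \<or> (d, c) \<in> r - Id" if bc: "(b, c) \<in> r - Id" and d: "d \<in> P"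
    proof -
      have P: "a \<in> P" "b \<in> P" "c \<in> P" using sub[OF ab] sub[OF bc] by auto
      then have "(f a, f b) \<in> s - Id" "(f b, f c) \<in> s - Id" using f ab bc by blast+
      then have "(f a, f d) \<in> s - Id \<or> (f d, f c) \<in> s - Id"
        using assms(3) range[OF d] unfolding semiorder_exchange_def by blast
      then show ?thesis using f P d by blast
    qed
  qed
qed

text \<open>
  If \<open>I < J < K\<close> while neither \<open>I < D\<close> nor \<open>D < K\<close>, then \<open>D\<close> has points on either side of \<open>J\<close> and contains
  \<open>J\<close> by convexity. This is where incomparability with respect to inclusion enters; the other exchange
  condition holds for arbitrary nonempty intervals.
\<close>

lemma semiorder_exchange_intervals:
  assumes lin: "linear_order_on C L"
    and intervals: "\<And>I. I \<in> \<J> \<Longrightarrow> interval_in C L I \<and> I \<noteq> {}"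
    and incomparable: "\<And>I J. I \<in> \<J> \<Longrightarrow> J \<in> \<J> \<Longrightarrow> I \<subseteq> J \<Longrightarrow> I = J"
  shows "semiorder_exchange \<J> (interval_ordering L \<J> - Id)"
proof -
  have sub: "I \<subseteq> C" and nonempty: "\<exists>x. x \<in> I" if "I \<in> \<J>" for I
    using intervals[OF that] by (auto simp: interval_in_def)
  have convex: "z \<in> I" if "I \<in> \<J>" "x \<in> I" "y \<in> I" "z \<in> C" "(x, z) \<in> L" "(z, y) \<in> L" for I x y z
    using intervals[OF that(1)] that unfolding interval_in_def by blast
  have tr: "trans L" and anti: "antisym L" and total: "total_on C L" and refl: "refl_on C L"
    using lin by (auto simp: order_on_defs)
  have not_less: "\<exists>x\<in>I. \<exists>y\<in>J. (y, x) \<in> L" if I: "I \<in> \<J>" and J: "J \<in> \<J>" and less: "\<not> interval_less L I J" for I J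
  proof -
    obtain x y where xy: "x \<in> I" "y \<in> J" and not_xy: "\<not> ((x, y) \<in> L \<and> x \<noteq> y)"
      using less unfolding interval_less_def by blast
    have "x \<in> C" "y \<in> C" using sub I J xy by blast+
    then have "(y, x) \<in> L"
      using total refl not_xy by (cases "x = y") (auto simp: total_on_def refl_on_def)
    then show ?thesis using xy by blast
  qed
  have strict: "(I, J) \<in> interval_ordering L \<J> - Id \<longleftrightarrow> I \<in> \<J> \<and> J \<in> \<J> \<and> interval_less L I J" for I J
    using nonempty unfolding interval_ordering_def interval_less_def by auto
  have two_two: "interval_less L I J' \<or> interval_less L I' J"
    if mem: "I \<in> \<J>" "J \<in> \<J>" "I' \<in> \<J>" "J' \<in> \<J>"
      and less: "interval_less L I J" "interval_less L I' J'" for I J I' J'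
  proof (rule ccontr)
    assume "\<not> ?thesis"
    then obtain a b c d where "a \<in> I" "d \<in> J'" "(d, a) \<in> L" "c \<in> I'" "b \<in> J" "(b, c) \<in> L"
      using not_less[OF mem(1,4)] not_less[OF mem(3,2)] by blast
    moreover from this have "(a, b) \<in> L" "(c, d) \<in> L" "a \<noteq> b"
      using less unfolding interval_less_def by blast+
    ultimately show False using tr anti by (meson antisymD transD)
  qed
  have three_one: "interval_less L I D \<or> interval_less L D K"
    if mem: "I \<in> \<J>" "J \<in> \<J>" "K \<in> \<J>" "D \<in> \<J>" and IJ: "interval_less L I J" and JK: "interval_less L J K"
    for I J K D
  proof (rule ccontr)
    assume no: "\<not> ?thesis"
    then obtain a d d' c where "a \<in> I" "d \<in> D" "(d, a) \<in> L" "d' \<in> D" "c \<in> K" "(c, d') \<in> L"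
      using not_less[OF mem(1,4)] not_less[OF mem(4,3)] by blast
    have "J \<subseteq> D"
    proof
      fix b assume b: "b \<in> J"
      then have "(a, b) \<in> L" "(b, c) \<in> L"
        using IJ JK \<open>a \<in> I\<close> \<open>c \<in> K\<close> unfolding interval_less_def by blast+
      then have "(d, b) \<in> L" "(b, d') \<in> L"
        using tr \<open>(d, a) \<in> L\<close> \<open>(c, d') \<in> L\<close> by (meson transD)+
      then show "b \<in> D" using convex mem(2,4) sub b \<open>d \<in> D\<close> \<open>d' \<in> D\<close> by blast
    qed
    then have "J = D" using incomparable mem by blast
    then show False using no IJ by blast
  qed
  show ?thesis
    unfolding semiorder_exchange_def strict using two_two three_one by blast
qed

text \<open>
  Both exchange conditions come from comparing \<open>b\<close> with \<open>d\<close>: totality of the predecessor preorder gives the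
  first, and the second uses in addition that it coincides with the successor preorder.
\<close>

lemma semiorder_exchange_threshold:
  assumes "threshold_order_on X r"
  shows "semiorder_exchange X (r - Id)"
proof -
  have sub: "r \<subseteq> X \<times> X" and total: "total_on X (le_pred X r)" and eq: "le_pred X r = le_succ X r"
    and refl: "refl_on X (le_pred X r)"
    using assms by (auto simp: threshold_order_on_def order_on_defs)
  have total': "(x, y) \<in> le_pred X r \<or> (y, x) \<in> le_pred X r" if "x \<in> X" "y \<in> X" for x y
    using total refl that by (cases "x = y") (auto simp: total_on_def refl_on_def)
  have pred: "(z, y) \<in> r - Id" if "(x, y) \<in> le_pred X r" "(z, x) \<in> r - Id" for x y z
    using that sub unfolding le_pred_def by blast
  have succ: "(x, z) \<in> r - Id" if "(x, y) \<in> le_pred X r" "(y, z) \<in> r - Id" for x y z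
    using that sub unfolding eq le_succ_def by blast
  show ?thesis
    unfolding semiorder_exchange_def
  proof (intro conjI allI impI)
    show "(a, d) \<in> r - Id \<or> (c, b) \<in> r - Id" if "(a, b) \<in> r - Id" "(c, d) \<in> r - Id" for a b c d
      using total'[of b d] pred that sub by blast
    show "(a, d) \<in> r - Id \<or> (d, c) \<in> r - Id"
      if "(a, b) \<in> r - Id" "(b, c) \<in> r - Id" "d \<in> X" for a b c d
      using total'[of b d] pred succ that sub by blast
  qed
qed


section \<open>Totally ordered abelian groups with a threshold\<close>

lemma (in ordered_group) translate_right_iff:
  assumes "x \<in> carrier G" "y \<in> carrier G" "z \<in> carrier G"
  shows "(x \<otimes> z, y \<otimes> z) \<in> r \<longleftrightarrow> (x, y) \<in> r"
proof
  assume "(x \<otimes> z, y \<otimes> z) \<in> r"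
  then have "(x \<otimes> z \<otimes> inv z, y \<otimes> z \<otimes> inv z) \<in> r"
    using assms by (intro right_translation[of "x \<otimes> z" "y \<otimes> z"]) auto
  moreover have "x \<otimes> z \<otimes> inv z = x" "y \<otimes> z \<otimes> inv z = y"
    using assms by (simp_all add: m_assoc)
  ultimately show "(x, y) \<in> r" by simp
qed (use assms right_translation in blast)

context totally_ordered_abelian_group
begin

lemma order_trans: "(x, y) \<in> r \<Longrightarrow> (y, z) \<in> r \<Longrightarrow> (x, z) \<in> r"
  using partial_order unfolding order_on_defs by (meson transD)

lemma order_antisym: "(x, y) \<in> r \<Longrightarrow> (y, x) \<in> r \<Longrightarrow> x = y"
  using partial_order unfolding order_on_defs by (meson antisymD)

lemma order_refl: "x \<in> carrier G \<Longrightarrow> (x, x) \<in> r"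
  using partial_order unfolding order_on_defs by (meson refl_onD)

lemma order_linear: "x \<in> carrier G \<Longrightarrow> y \<in> carrier G \<Longrightarrow> (x, y) \<in> r \<or> (y, x) \<in> r"
  using linear_order order_refl[of x] by (cases "x = y") (auto simp: order_on_defs total_on_def)

lemma order_closed: "(x, y) \<in> r \<Longrightarrow> x \<in> carrier G \<and> y \<in> carrier G"
  using partial_order unfolding order_on_defs by blast

end

locale attained_threshold = totally_ordered_abelian_group G r
  for G :: "'g monoid" (structure) and r +
  fixes \<alpha>
  assumes positive: "positive_in G r \<alpha>"
begin

lemma \<alpha>_closed [simp]: "\<alpha> \<in> carrier G"
  and \<alpha>_pos: "(\<one>, \<alpha>) \<in> r" "\<alpha> \<noteq> \<one>"
  using positive by (auto simp: positive_in_def)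

lemma threshold_rel_iff:
  assumes "x \<in> carrier G" "y \<in> carrier G"
  shows "(x, y) \<in> threshold_rel G r \<alpha> \<longleftrightarrow> x = y \<or> (x \<otimes> \<alpha>, y) \<in> r"
proof -
  have "(\<alpha>, y \<otimes> inv x) \<in> r \<longleftrightarrow> (\<alpha> \<otimes> x, y \<otimes> inv x \<otimes> x) \<in> r"
    using assms translate_right_iff by simp
  moreover have "y \<otimes> inv x \<otimes> x = y" using assms by (simp add: m_assoc)
  ultimately show ?thesis
    using assms m_comm[of \<alpha> x] by (simp add: threshold_rel_def)
qed

lemma less_translate_positive:
  assumes "x \<in> carrier G"
  shows "(x, x \<otimes> \<alpha>) \<in> r" "(x \<otimes> \<alpha>, x) \<notin> r"
proof -
  show le: "(x, x \<otimes> \<alpha>) \<in> r"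
    using left_translation[OF one_closed \<alpha>_closed assms \<alpha>_pos(1)] assms by simp
  show "(x \<otimes> \<alpha>, x) \<notin> r"
    using order_antisym[OF le] \<alpha>_pos(2) assms r_cancel_one[of x \<alpha>] by auto
qed

lemma strict_threshold_rel_iff:
  assumes "x \<in> carrier G" "y \<in> carrier G"
  shows "(x, y) \<in> threshold_rel G r \<alpha> \<and> x \<noteq> y \<longleftrightarrow> (x \<otimes> \<alpha>, y) \<in> r"
proof -
  show ?thesis
    using threshold_rel_iff[OF assms] less_translate_positive assms by auto
qed

text \<open>
  Testing the predecessors \<open>x - \<alpha>\<close> and the successors \<open>y + \<alpha>\<close> shows that both associated preorders are the
  given total order of the group.
\<close>

lemma threshold_group_threshold_rel:
  shows "threshold_group G (threshold_rel G r \<alpha>)"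
proof -
  let ?s = "threshold_rel G r \<alpha>"
  note iff = threshold_rel_iff and strict = strict_threshold_rel_iff
  have sub: "?s \<subseteq> carrier G \<times> carrier G" by (auto simp: threshold_rel_def)
  have increasing: "(x, y) \<in> r" if "(x, y) \<in> ?s" for x y
    using that sub iff[of x y] less_translate_positive(1)[of x] order_trans order_refl by blast
  have "trans ?s"
  proof (rule transI)
    fix x y z assume xy: "(x, y) \<in> ?s" and yz: "(y, z) \<in> ?s"
    have c: "x \<in> carrier G" "y \<in> carrier G" "z \<in> carrier G" using xy yz sub by auto
    have "(y, z) \<in> r" using yz by (rule increasing)
    then show "(x, z) \<in> ?s" using xy yz iff[of x y] iff[of x z] c order_trans by blast
  qed
  moreover have "antisym ?s"
    using increasing order_antisym by (auto intro: antisymI)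
  ultimately have po: "partial_order_on (carrier G) ?s"
    using sub by (auto simp: order_on_defs refl_on_def threshold_rel_def)
  have right: "(x \<otimes> z, y \<otimes> z) \<in> ?s"
    if "x \<in> carrier G" "y \<in> carrier G" "z \<in> carrier G" "(x, y) \<in> ?s" for x y z
  proof -
    have "x \<otimes> z \<otimes> \<alpha> = x \<otimes> \<alpha> \<otimes> z" using that by (simp add: m_ac)
    then show ?thesis
      using that \<alpha>_closed iff[of x y] iff[of "x \<otimes> z" "y \<otimes> z"] right_translation[of "x \<otimes> \<alpha>" y z] by auto
  qed
  have "ordered_group G ?s"
  proof
    show "(z \<otimes> x, z \<otimes> y) \<in> ?s"
      if "x \<in> carrier G" "y \<in> carrier G" "z \<in> carrier G" "(x, y) \<in> ?s" for x y z
      using right[OF that] that by (simp add: m_comm)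
  qed (use po right in auto)
  moreover have "le_pred (carrier G) ?s = r"
  proof (intro equalityI subrelI)
    fix x y assume "(x, y) \<in> le_pred (carrier G) ?s"
    then have xy: "x \<in> carrier G" "y \<in> carrier G"
      and pred: "\<And>z. z \<in> carrier G \<Longrightarrow> (z \<otimes> \<alpha>, x) \<in> r \<Longrightarrow> (z \<otimes> \<alpha>, y) \<in> r"
      unfolding le_pred_def using strict by blast+
    have "x \<otimes> inv \<alpha> \<otimes> \<alpha> = x" using xy \<alpha>_closed by (simp add: m_assoc)
    then show "(x, y) \<in> r" using pred[of "x \<otimes> inv \<alpha>"] xy \<alpha>_closed order_refl by simp
  next
    fix x y assume xy: "(x, y) \<in> r"
    then show "(x, y) \<in> le_pred (carrier G) ?s"
      unfolding le_pred_def using strict order_closed[OF xy] order_trans[OF _ xy] by blast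
  qed
  moreover have "le_succ (carrier G) ?s = r"
  proof (intro equalityI subrelI)
    fix x y assume "(x, y) \<in> le_succ (carrier G) ?s"
    then have xy: "x \<in> carrier G" "y \<in> carrier G"
      and succ: "\<And>z. z \<in> carrier G \<Longrightarrow> (y \<otimes> \<alpha>, z) \<in> r \<Longrightarrow> (x \<otimes> \<alpha>, z) \<in> r"
      unfolding le_succ_def using strict by blast+
    then show "(x, y) \<in> r"
      using succ[of "y \<otimes> \<alpha>"] \<alpha>_closed order_refl translate_right_iff by simp
  next
    fix x y assume xy: "(x, y) \<in> r"
    have c: "x \<in> carrier G" "y \<in> carrier G" using order_closed[OF xy] by auto
    have "(x \<otimes> \<alpha>, y \<otimes> \<alpha>) \<in> r" using right_translation c \<alpha>_closed xy by blast
    from order_trans[OF this] show "(x, y) \<in> le_succ (carrier G) ?s"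
      unfolding le_succ_def using strict c by blast
  qed
  ultimately show ?thesis
    using po linear_order by (simp add: threshold_group_def threshold_order_on_def)
qed

lemma mem_half_open_interval:
  assumes "x \<in> carrier G"
  shows "y \<in> half_open_interval G r \<alpha> x \<longleftrightarrow> (x, y) \<in> r \<and> (x \<otimes> \<alpha>, y) \<notin> r"
proof -
  have "x \<otimes> \<alpha> \<in> carrier G" using assms by simp
  then show ?thesis
    unfolding half_open_interval_def
    using order_linear order_antisym order_refl order_closed by blast
qed

text \<open>
  If \<open>[x, x + \<alpha>[\<close> lies in \<open>[y, y + \<alpha>[\<close> with \<open>y < x\<close>, then \<open>x < y + \<alpha> < x + \<alpha>\<close>, so \<open>y + \<alpha>\<close> belongs to the first
  interval and not to the second.
\<close>

lemma half_open_interval_antichain: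
  assumes x: "x \<in> carrier G" and y: "y \<in> carrier G"
    and sub: "half_open_interval G r \<alpha> x \<subseteq> half_open_interval G r \<alpha> y"
  shows "x = y"
proof (rule ccontr)
  assume "x \<noteq> y"
  note mem = mem_half_open_interval
  have x_in: "(y, x) \<in> r" "(y \<otimes> \<alpha>, x) \<notin> r"
    using sub mem[OF x, of x] mem[OF y, of x] order_refl[OF x] less_translate_positive[OF x] by auto
  have "(x, y \<otimes> \<alpha>) \<in> r" using x_in order_linear x y \<alpha>_closed by blast
  moreover have "(x \<otimes> \<alpha>, y \<otimes> \<alpha>) \<notin> r"
    using translate_right_iff[OF x y \<alpha>_closed] x_in(1) \<open>x \<noteq> y\<close> order_antisym by blast
  ultimately have "y \<otimes> \<alpha> \<in> half_open_interval G r \<alpha> x" using mem x by blast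
  then show False using sub mem[OF y] order_refl y \<alpha>_closed by auto
qed

lemma interval_less_half_open:
  assumes x: "x \<in> carrier G" and y: "y \<in> carrier G"
  shows "interval_less r (half_open_interval G r \<alpha> x) (half_open_interval G r \<alpha> y) \<longleftrightarrow>
    (x \<otimes> \<alpha>, y) \<in> r"
proof
  note mem = mem_half_open_interval
  note less = less_translate_positive
  assume "interval_less r (half_open_interval G r \<alpha> x) (half_open_interval G r \<alpha> y)"
  moreover have "x \<in> half_open_interval G r \<alpha> x" "y \<in> half_open_interval G r \<alpha> y"
    using mem[OF x] mem[OF y] less[OF x] less[OF y] order_refl x y by auto
  ultimately have "(x, y) \<in> r" "y \<notin> half_open_interval G r \<alpha> x"
    unfolding interval_less_def by blast+
  then show "(x \<otimes> \<alpha>, y) \<in> r" using mem[OF x] by blast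
next
  note mem = mem_half_open_interval
  assume le: "(x \<otimes> \<alpha>, y) \<in> r"
  have x\<alpha>_closed: "x \<otimes> \<alpha> \<in> carrier G" using x by simp
  show "interval_less r (half_open_interval G r \<alpha> x) (half_open_interval G r \<alpha> y)"
    unfolding interval_less_def
  proof (intro ballI)
    fix u v assume "u \<in> half_open_interval G r \<alpha> x" "v \<in> half_open_interval G r \<alpha> y"
    then have u: "(x, u) \<in> r" "(x \<otimes> \<alpha>, u) \<notin> r" and "(y, v) \<in> r"
      by (simp_all add: mem[OF x] mem[OF y])
    have "(u, x \<otimes> \<alpha>) \<in> r" using order_linear[OF _ x\<alpha>_closed, of u] order_closed[OF u(1)] u(2) by blast
    then have "(u, y) \<in> r" using le by (rule order_trans)
    then have "(u, v) \<in> r" using \<open>(y, v) \<in> r\<close> by (rule order_trans)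
    moreover have "(x \<otimes> \<alpha>, v) \<in> r" using le \<open>(y, v) \<in> r\<close> by (rule order_trans)
    ultimately show "(u, v) \<in> r \<and> u \<noteq> v" using u(2) by blast
  qed
qed

lemma interval_in_half_open:
  assumes x: "x \<in> carrier G"
  shows "interval_in (carrier G) r (half_open_interval G r \<alpha> x)" "half_open_interval G r \<alpha> x \<noteq> {}"
proof -
  note mem = mem_half_open_interval[OF x]
  show "interval_in (carrier G) r (half_open_interval G r \<alpha> x)"
    unfolding interval_in_def
  proof (intro conjI subsetI ballI impI)
    fix u v w
    assume "u \<in> half_open_interval G r \<alpha> x" "v \<in> half_open_interval G r \<alpha> x" "(u, w) \<in> r \<and> (w, v) \<in> r"
    then have "(x, u) \<in> r" "(u, w) \<in> r" and v: "(x \<otimes> \<alpha>, v) \<notin> r" "(w, v) \<in> r"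
      using mem by blast+
    then have "(x, w) \<in> r" by (intro order_trans[of x u w])
    moreover have "(x \<otimes> \<alpha>, w) \<notin> r" using order_trans[OF _ v(2)] v(1) by blast
    ultimately show "w \<in> half_open_interval G r \<alpha> x" using mem by blast
  qed (simp add: half_open_interval_def)
  show "half_open_interval G r \<alpha> x \<noteq> {}"
  proof -
    have "x \<in> half_open_interval G r \<alpha> x"
      using mem order_refl[OF x] less_translate_positive(2)[OF x] by blast
    then show ?thesis by blast
  qed
qed

end


section \<open>Implications between the representations\<close>

lemma group_intervals_imp_incomparable_intervals:
  assumes "rep_by_group_intervals TYPE('g) P r"
  shows "rep_by_incomparable_intervals TYPE('g) P r"
proof -
  obtain G :: "'g monoid" and L \<alpha> \<J> where G: "totally_ordered_abelian_group G L"
    and pos: "positive_in G L \<alpha>"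
    and \<J>: "\<forall>J\<in>\<J>. \<exists>x\<in>carrier G. J = half_open_interval G L \<alpha> x"
    and iso: "poset_isomorphic P r \<J> (interval_ordering L \<J>)"
    using assms unfolding rep_by_group_intervals_def by blast
  interpret attained_threshold G L \<alpha>
    using G pos by (simp add: attained_threshold_def attained_threshold_axioms_def)
  have incomparable: "I = J" if "I \<in> \<J>" "J \<in> \<J>" "I \<subseteq> J" for I J
    using \<J> that half_open_interval_antichain by metis
  have "interval_in (carrier G) L I \<and> I \<noteq> {}" if "I \<in> \<J>" for I
    using \<J> that interval_in_half_open by metis
  then show ?thesis
    unfolding rep_by_incomparable_intervals_def
    by (intro exI[of _ "carrier G"] exI[of _ L] exI[of _ \<J>] conjI linear_order iso)
      (use incomparable in blast)+
qed

lemma attained_threshold_imp_group_intervals: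
  assumes "embeds_in_attained_threshold_group TYPE('g) P r"
  shows "rep_by_group_intervals TYPE('g) P r"
proof -
  obtain G :: "'g monoid" and L \<alpha> f where G: "totally_ordered_abelian_group G L"
    and pos: "positive_in G L \<alpha>"
    and f: "poset_embedding P r (carrier G) (threshold_rel G L \<alpha>) f"
    using assms unfolding embeds_in_attained_threshold_group_def
      abelian_threshold_group_attained_def poset_embeds_def by blast
  interpret attained_threshold G L \<alpha>
    using G pos by (simp add: attained_threshold_def attained_threshold_axioms_def)
  have fG: "f x \<in> carrier G" if "x \<in> P" for x using f that by (auto simp: poset_embedding_def)
  have f_inj: "x = y" if "x \<in> P" "y \<in> P" "f x = f y" for x y
    using f that by (auto simp: poset_embedding_def inj_on_def)
  have f_rel: "(f x, f y) \<in> threshold_rel G L \<alpha> \<longleftrightarrow> (x, y) \<in> r" if "x \<in> P" "y \<in> P" for x y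
    using f that by (auto simp: poset_embedding_def)
  define h where "h x = half_open_interval G L \<alpha> (f x)" for x
  have h_inj: "x = y" if "x \<in> P" "y \<in> P" "h x = h y" for x y
    using half_open_interval_antichain[of "f x" "f y"] fG that f_inj unfolding h_def by blast
  have "(h x, h y) \<in> interval_ordering L (h ` P) \<longleftrightarrow> (x, y) \<in> r" if "x \<in> P" "y \<in> P" for x y
  proof -
    have "(h x, h y) \<in> interval_ordering L (h ` P) \<longleftrightarrow> f x = f y \<or> (f x \<otimes>\<^bsub>G\<^esub> \<alpha>, f y) \<in> L"
      using that h_inj[OF that] f_inj[OF that] interval_less_half_open[of "f x" "f y"] fG
      unfolding interval_ordering_def h_def by auto
    then show ?thesis using threshold_rel_iff[of "f x" "f y"] fG f_rel that by blast
  qed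
  then have "poset_embedding P r (h ` P) (interval_ordering L (h ` P)) h"
    unfolding poset_embedding_def inj_on_def using h_inj by blast
  then have "poset_isomorphic P r (h ` P) (interval_ordering L (h ` P))"
    unfolding poset_isomorphic_def by blast
  moreover have "\<forall>J\<in>h ` P. \<exists>x\<in>carrier G. J = half_open_interval G L \<alpha> x"
    using fG h_def by blast
  ultimately show ?thesis
    unfolding rep_by_group_intervals_def using G pos by metis
qed

lemma attained_threshold_imp_threshold:
  assumes "embeds_in_attained_threshold_group TYPE('g) P r"
  shows "embeds_in_threshold_group TYPE('g) P r"
proof -
  obtain G :: "'g monoid" and L \<alpha> where G: "totally_ordered_abelian_group G L"
    and pos: "positive_in G L \<alpha>"
    and emb: "poset_embeds P r (carrier G) (threshold_rel G L \<alpha>)"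
    using assms unfolding embeds_in_attained_threshold_group_def
      abelian_threshold_group_attained_def by blast
  interpret attained_threshold G L \<alpha>
    using G pos by (simp add: attained_threshold_def attained_threshold_axioms_def)
  show ?thesis
    unfolding embeds_in_threshold_group_def using threshold_group_threshold_rel emb by blast
qed

lemma incomparable_intervals_imp_semiorder:
  assumes po: "partial_order_on P r" and rep: "rep_by_incomparable_intervals TYPE('c) P r"
  shows "semiorder_on P r"
proof -
  obtain C :: "'c set" and L \<J> where lin: "linear_order_on C L"
    and intervals: "\<forall>I\<in>\<J>. interval_in C L I \<and> I \<noteq> {}"
    and incomparable: "\<forall>I\<in>\<J>. \<forall>J\<in>\<J>. I \<noteq> J \<longrightarrow> \<not> I \<subseteq> J \<and> \<not> J \<subseteq> I"
    and iso: "poset_isomorphic P r \<J> (interval_ordering L \<J>)"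
    using rep unfolding rep_by_incomparable_intervals_def by (elim exE conjE) (rule that)
  obtain f where f: "poset_embedding P r \<J> (interval_ordering L \<J>) f"
    using iso unfolding poset_isomorphic_def by blast
  have "semiorder_exchange \<J> (interval_ordering L \<J> - Id)"
    by (rule semiorder_exchange_intervals[OF lin]) (use intervals incomparable in blast)+
  then have "semiorder_exchange P (r - Id)"
    using semiorder_exchange_embedding[OF f] po unfolding order_on_defs by blast
  then show ?thesis using semiorder_on_iff_exchange[OF po] by blast
qed

lemma threshold_imp_semiorder:
  assumes po: "partial_order_on P r" and emb: "embeds_in_threshold_group TYPE('g) P r"
  shows "semiorder_on P r"
proof -
  obtain G :: "'g monoid" and s f where thr: "threshold_order_on (carrier G) s"
    and f: "poset_embedding P r (carrier G) s f"
    using emb unfolding embeds_in_threshold_group_def threshold_group_def poset_embeds_def by blast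
  have "semiorder_exchange P (r - Id)"
    using semiorder_exchange_embedding[OF f _ semiorder_exchange_threshold[OF thr]] po
    unfolding order_on_defs by blast
  then show ?thesis using semiorder_on_iff_exchange[OF po] by blast
qed


section \<open>Linear refinements and weighted walks\<close>

text \<open>
  The preorder \<open>W\<close> below compares two elements by their sets of predecessors and of successors; the
  exchange conditions say precisely that it is total. Both absorption laws hold for \<open>W\<close> by construction,
  so breaking its ties by an arbitrary linear order keeps them.
\<close>

lemma linear_refinement:
  assumes exchange: "semiorder_exchange P A" and sub: "A \<subseteq> P \<times> P" and irrefl: "irrefl A"
  obtains T where "trans T" "irrefl T" "total_on P T" "T \<subseteq> P \<times> P" "A \<subseteq> T"
    "A O T \<subseteq> A" "T O A \<subseteq> A"
proof -
  have A_irrefl: "(x, x) \<notin> A" for x using irrefl by (simp add: irrefl_def)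
  have two_two: "(a, d) \<in> A \<or> (c, b) \<in> A" if "(a, b) \<in> A" "(c, d) \<in> A" for a b c d
    using exchange that unfolding semiorder_exchange_def by blast
  have three_one: "(a, d) \<in> A \<or> (d, c) \<in> A" if "(a, b) \<in> A" "(b, c) \<in> A" "d \<in> P" for a b c d
    using exchange that unfolding semiorder_exchange_def by blast
  have A_trans: "(a, c) \<in> A" if "(a, b) \<in> A" "(b, c) \<in> A" for a b c
    using three_one[OF that, of a] sub that A_irrefl by blast
  define W where "W = {(x, y). x \<in> P \<and> y \<in> P \<and>
    (\<forall>z. (z, x) \<in> A \<longrightarrow> (z, y) \<in> A) \<and> (\<forall>z. (y, z) \<in> A \<longrightarrow> (x, z) \<in> A)}"
  have W_trans: "(x, z) \<in> W" if "(x, y) \<in> W" "(y, z) \<in> W" for x y z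
    using that unfolding W_def by blast
  have W_total: "(x, y) \<in> W \<or> (y, x) \<in> W" if "x \<in> P" "y \<in> P" for x y
  proof (rule ccontr)
    assume "\<not> ?thesis"
    then have "(\<exists>z. (z, x) \<in> A \<and> (z, y) \<notin> A) \<or> (\<exists>z. (y, z) \<in> A \<and> (x, z) \<notin> A)"
      "(\<exists>z. (z, y) \<in> A \<and> (z, x) \<notin> A) \<or> (\<exists>z. (x, z) \<in> A \<and> (y, z) \<notin> A)"
      using that unfolding W_def by blast+
    then show False
    proof (elim disjE exE conjE)
      (* A disagreement on the same side is excluded by the first exchange condition, a disagreement
         on opposite sides by the second. *)
      show False if "(z, x) \<in> A" "(z, y) \<notin> A" "(z', y) \<in> A" "(z', x) \<notin> A" for z z'
        using two_two[OF that(1,3)] that(2,4) by blast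
      show False if "(z, x) \<in> A" "(z, y) \<notin> A" "(x, z') \<in> A" "(y, z') \<notin> A" for z z'
        using three_one[OF that(1,3) \<open>y \<in> P\<close>] that(2,4) by blast
      show False if "(y, z) \<in> A" "(x, z) \<notin> A" "(z', y) \<in> A" "(z', x) \<notin> A" for z z'
        using three_one[OF that(3,1) \<open>x \<in> P\<close>] that(2,4) by blast
      show False if "(y, z) \<in> A" "(x, z) \<notin> A" "(x, z') \<in> A" "(y, z') \<notin> A" for z z'
        using two_two[OF that(1,3)] that(2,4) by blast
    qed
  qed
  have A_W: "(x, y) \<in> W \<and> (y, x) \<notin> W" if "(x, y) \<in> A" for x y
    using that sub A_trans A_irrefl unfolding W_def by blast
  obtain L :: "'a rel" where "well_order_on UNIV L" using well_order_on by blast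
  then have L: "trans L" "antisym L" "total L"
    by (auto simp: order_on_defs)
  define T where "T = {(x, y). (x, y) \<in> W \<and> ((y, x) \<notin> W \<or> (x, y) \<in> L \<and> x \<noteq> y)}"
  have T_W: "T \<subseteq> W" unfolding T_def by blast
  show thesis
  proof
    show "trans T"
    proof (rule transI)
      fix x y z assume xy: "(x, y) \<in> T" and yz: "(y, z) \<in> T"
      have "(x, z) \<in> W" using xy yz T_W W_trans by blast
      moreover have "(x, z) \<in> L \<and> x \<noteq> z" if "(z, x) \<in> W"
      proof -
        have "(y, x) \<in> W" "(z, y) \<in> W" using xy yz that T_W W_trans by blast+
        then have "(x, y) \<in> L" "x \<noteq> y" "(y, z) \<in> L" using xy yz unfolding T_def by auto
        then show ?thesis using L by (metis antisymD transD)
      qed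
      ultimately show "(x, z) \<in> T" unfolding T_def by blast
    qed
    show "irrefl T" unfolding T_def irrefl_def by blast
    show "total_on P T"
      using W_total L(3) unfolding total_on_def T_def by blast
    show "T \<subseteq> P \<times> P" unfolding T_def W_def by blast
    show "A \<subseteq> T" using A_W unfolding T_def by blast
    show "A O T \<subseteq> A" "T O A \<subseteq> A" using T_W unfolding W_def by blast+
  qed
qed

lemma relpow_absorb_right:
  fixes X T :: "'a rel"
  assumes "X O T \<subseteq> X" "0 < i"
  shows "X ^^ i O T \<subseteq> X ^^ i"
proof -
  obtain k where i: "i = Suc k" using assms(2) by (cases i) auto
  have "X ^^ k O (X O T) \<subseteq> X ^^ k O X" using assms(1) by blast
  then show ?thesis by (simp add: i O_assoc)
qed

lemma relpow_absorb_left: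
  fixes T Y :: "'a rel"
  assumes "T O Y \<subseteq> Y" "0 < i"
  shows "T O Y ^^ i \<subseteq> Y ^^ i"
proof -
  obtain k where i: "i = Suc k" using assms(2) by (cases i) auto
  have "(T O Y) O Y ^^ k \<subseteq> Y O Y ^^ k" using assms(1) by blast
  then show ?thesis by (simp add: i relpow_commute O_assoc)
qed

text \<open>
  Steps of \<open>X\<close> and \<open>Y\<close> play the role of opposite translations: an adjacent pair collapses to an element of
  \<open>T\<close>, which is then swallowed by whatever stands next to it, so only the surplus of one kind survives.
\<close>

lemma relpow_cancel:
  assumes "X O Y \<subseteq> T" "X O T \<subseteq> X" "T O Y \<subseteq> Y"
  shows "X ^^ Suc i O Y ^^ Suc j \<subseteq>
    (if i < j then Y ^^ (j - i) else if j < i then X ^^ (i - j) else T)"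
proof (induction i arbitrary: j)
  case 0
  show ?case
  proof (cases "j = 0")
    case True
    then show ?thesis using assms(1) by simp
  next
    case False
    have "X O Y ^^ Suc j = (X O Y) O Y ^^ j"
      by (simp add: relpow_commute O_assoc)
    also have "\<dots> \<subseteq> T O Y ^^ j" using assms(1) by blast
    also have "\<dots> \<subseteq> Y ^^ j" using False assms(3) relpow_absorb_left by blast
    finally show ?thesis using False by simp
  qed
next
  case (Suc i)
  have "X ^^ Suc (Suc i) O Y ^^ Suc j = X ^^ Suc i O (X O Y) O Y ^^ j"
    by (simp add: relpow_commute O_assoc)
  also have "\<dots> \<subseteq> X ^^ Suc i O T O Y ^^ j" using assms(1) by blast
  finally have step: "X ^^ Suc (Suc i) O Y ^^ Suc j \<subseteq> X ^^ Suc i O T O Y ^^ j" .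
  show ?case
  proof (cases j)
    case 0
    then show ?thesis
      using step relpow_absorb_right[OF assms(2), of "Suc i"] by auto
  next
    case (Suc j')
    have "X ^^ Suc i O T O Y ^^ j \<subseteq> X ^^ Suc i O Y ^^ j"
      using relpow_absorb_left[OF assms(3), of j] Suc by blast
    with step have "X ^^ Suc (Suc i) O Y ^^ Suc j \<subseteq> X ^^ Suc i O Y ^^ Suc j'"
      unfolding Suc by (rule subset_trans)
    from subset_trans[OF this Suc.IH] show ?thesis
      by (simp only: Suc Suc_less_eq diff_Suc_Suc)
  qed
qed

text \<open>
  These are the normal forms of walks in the graph whose edges \<open>A\<close>, \<open>T\<close> and \<open>N\<close> carry the weights \<open>-1\<close>, \<open>0\<close>
  and \<open>1\<close>. For a representation of a semiorder by points \<open>f x\<close> of an ordered group with threshold \<open>\<alpha>\<close>,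
  a walk of weight \<open>n\<close> from \<open>x\<close> to \<open>y\<close> stands for the constraint \<open>f y - f x + n \<alpha> > 0\<close>.
\<close>

definition weighted_walk :: "'a rel \<Rightarrow> 'a rel \<Rightarrow> 'a rel \<Rightarrow> int \<Rightarrow> 'a rel" where
  "weighted_walk A N T n = (if 0 < n then N ^^ nat n else if n < 0 then A ^^ nat (- n) else T)"

text \<open>
  Edges of weights \<open>1\<close> and \<open>-1\<close> cancel, so every walk can be replaced by one whose edges all have the same
  sign; hence the normal forms are closed under concatenation.
\<close>

lemma weighted_walk_compose:
  assumes AT: "A O T \<subseteq> A" and TA: "T O A \<subseteq> A" and NT: "N O T \<subseteq> N" and TN: "T O N \<subseteq> N"
    and AN: "A O N \<subseteq> T" and NA: "N O A \<subseteq> T" and TT: "trans T"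
  shows "weighted_walk A N T m O weighted_walk A N T n \<subseteq> weighted_walk A N T (m + n)"
proof -
  have pos: "weighted_walk A N T (int (Suc i)) = N ^^ Suc i"
    and neg: "weighted_walk A N T (- int (Suc i)) = A ^^ Suc i" for i
    by (simp_all add: weighted_walk_def nat_add_distrib)
  have cases_int: "k = 0 \<or> (\<exists>i. k = int (Suc i)) \<or> (\<exists>i. k = - int (Suc i))" for k :: int
    by (metis int_cases2 nat.exhaust of_nat_0 minus_zero)
  have add: "X ^^ Suc i O X ^^ Suc j = X ^^ Suc (Suc (i + j))" for X :: "'a rel" and i j
    by (simp only: relpow_add[symmetric]) simp
  have T: "T O T \<subseteq> T" using TT by (simp add: trans_O_subset)
  (* The weights 0 are separated off because the zeroth relational power is the identity, not T. *)
  consider "m = 0" | "n = 0" | i j where "m = int (Suc i)" "n = int (Suc j)"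
    | i j where "m = - int (Suc i)" "n = - int (Suc j)"
    | i j where "m = int (Suc i)" "n = - int (Suc j)"
    | i j where "m = - int (Suc i)" "n = int (Suc j)"
    using cases_int by metis
  then show ?thesis
  proof cases
    case 1
    then show ?thesis
      using relpow_absorb_left[OF TN] relpow_absorb_left[OF TA] T by (simp add: weighted_walk_def)
  next
    case 2
    then show ?thesis
      using relpow_absorb_right[OF NT] relpow_absorb_right[OF AT] T by (simp add: weighted_walk_def)
  next
    case 3
    then have "m + n = int (Suc (Suc (i + j)))" by simp
    then show ?thesis by (simp only: 3 pos add subset_refl)
  next
    case 4
    then have "m + n = - int (Suc (Suc (i + j)))" by simp
    then show ?thesis by (simp only: 4 neg add subset_refl)
  next
    case 5
    have "weighted_walk A N T (m + n) =
        (if i < j then A ^^ (j - i) else if j < i then N ^^ (i - j) else T)"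
      by (auto simp: 5 weighted_walk_def nat_diff_distrib)
    then show ?thesis
      using relpow_cancel[OF NA NT TA, of i j] by (simp only: 5 pos neg)
  next
    case 6
    have "weighted_walk A N T (m + n) =
        (if i < j then N ^^ (j - i) else if j < i then A ^^ (i - j) else T)"
      by (auto simp: 6 weighted_walk_def nat_diff_distrib)
    then show ?thesis
      using relpow_cancel[OF AN AT TN, of i j] by (simp only: 6 pos neg)
  qed
qed

text \<open>
  This is the consistency of the constraints: in normal form, a closed walk of weight at most \<open>0\<close> would be a
  strictly increasing cycle of the linear order \<open>T\<close>.
\<close>

lemma weighted_walk_loop:
  assumes "A \<subseteq> T" "trans T" "irrefl T" "(x, x) \<in> weighted_walk A N T n"
  shows "0 < n"
proof (rule ccontr)
  assume "\<not> 0 < n"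
  have "A ^^ k \<subseteq> T" if "0 < k" for k
  proof -
    have "A ^^ k \<subseteq> A\<^sup>+" using that trancl_power[of _ A] by blast
    also have "\<dots> \<subseteq> T\<^sup>+" using assms(1) trancl_mono by blast
    finally show ?thesis using assms(2) by simp
  qed
  then have "weighted_walk A N T n \<subseteq> T"
    using \<open>\<not> 0 < n\<close> by (simp add: weighted_walk_def)
  then show False using assms(3,4) by (auto simp: irrefl_def)
qed


section \<open>Positive cones of total group orders\<close>

text \<open>
  A maximal semigroup \<open>M\<close> that contains \<open>S\<close> and omits \<open>0\<close> is total. If \<open>x\<close> cannot be adjoined to \<open>M\<close>, then
  some \<open>s + n x\<close> vanishes, and torsion-freeness rules out \<open>s = 0\<close>; so \<open>M\<close> contains a negative multiple of \<open>x\<close>.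
  If neither \<open>x\<close> nor \<open>- x\<close> can be adjoined, \<open>M\<close> contains a negative and a positive multiple of \<open>x\<close>, and
  thus \<open>0\<close>.
\<close>

lemma extend_to_total_cone:
  fixes S :: "'g::ab_group_add set"
  assumes torsion_free: "\<And>n x. 0 < n \<Longrightarrow> (\<Sum>i<n::nat. x :: 'g) = 0 \<Longrightarrow> x = 0"
    and closed: "\<And>x y. x \<in> S \<Longrightarrow> y \<in> S \<Longrightarrow> x + y \<in> S"
    and zero: "0 \<notin> S"
  obtains Q where "S \<subseteq> Q" "0 \<notin> Q" "\<And>x y. x \<in> Q \<Longrightarrow> y \<in> Q \<Longrightarrow> x + y \<in> Q"
    "\<And>x. x \<noteq> 0 \<Longrightarrow> x \<in> Q \<or> - x \<in> Q"
proof -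
  define \<A> where "\<A> = {Q. S \<subseteq> Q \<and> 0 \<notin> Q \<and> (\<forall>x\<in>Q. \<forall>y\<in>Q. x + y \<in> Q)}"
  have "\<exists>M\<in>\<A>. \<forall>X\<in>\<A>. M \<subseteq> X \<longrightarrow> X = M"
  proof (rule subset_Zorn_nonempty)
    show "\<A> \<noteq> {}"
      using closed zero unfolding \<A>_def by blast
    fix \<C> assume "\<C> \<noteq> {}" and chain: "subset.chain \<A> \<C>"
    have sub: "\<C> \<subseteq> \<A>"
      using chain by (simp add: subset_chain_def)
    have "x + y \<in> \<Union>\<C>" if x: "x \<in> \<Union>\<C>" and y: "y \<in> \<Union>\<C>" for x y
    proof -
      obtain X Y where XY: "X \<in> \<C>" "x \<in> X" "Y \<in> \<C>" "y \<in> Y" using x y by blast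
      have "X \<subseteq> Y \<or> Y \<subseteq> X" using chain XY by (auto simp: subset_chain_def)
      then show ?thesis using XY sub unfolding \<A>_def by blast
    qed
    then show "\<Union>\<C> \<in> \<A>" using sub \<open>\<C> \<noteq> {}\<close> unfolding \<A>_def by blast
  qed
  then obtain M where M: "M \<in> \<A>" and maximal: "\<And>X. X \<in> \<A> \<Longrightarrow> M \<subseteq> X \<Longrightarrow> X = M"
    by blast
  have M_closed: "x + y \<in> M" if "x \<in> M" "y \<in> M" for x y
    using M that by (simp add: \<A>_def)
  have M_zero: "0 \<notin> M" using M by (simp add: \<A>_def)
  define mult where "mult n x = (\<Sum>i<n. x)" for n :: nat and x :: 'g
  have mult_add: "mult (m + n) x = mult m x + mult n x" for m n x
    unfolding mult_def by (induction n) (auto simp: algebra_simps)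
  have mult_M: "mult n x \<in> M" if "0 < n" "x \<in> M" for n x
    using that
  proof (induction n)
    case (Suc n)
    then show ?case by (cases n) (auto simp: mult_def M_closed)
  qed simp
  have negative_multiple: "\<exists>n>0. - mult n x \<in> M" if "x \<noteq> 0" "x \<notin> M" for x
  proof -
    (* The semigroup generated by M and x. *)
    define M' where "M' = M \<union> {s + mult n x | s n. s \<in> insert 0 M \<and> 0 < n}"
    have "x \<in> M'"
      unfolding M'_def by (intro UnI2 CollectI exI[of _ 0] exI[of _ 1]) (simp add: mult_def)
    then have "M' \<notin> \<A>" using maximal[of M'] that unfolding M'_def by auto
    moreover have "a + b \<in> M'" if ab: "a \<in> M'" "b \<in> M'" for a b
    proof -
      have *: "s + mult n x + (t + mult m x) \<in> M'"
        if "s \<in> insert 0 M" "t \<in> insert 0 M" "0 < n + m" for s t n m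
      proof -
        have "s + mult n x + (t + mult m x) = (s + t) + mult (n + m) x"
          by (simp add: mult_add algebra_simps)
        moreover have "s + t \<in> insert 0 M" using that M_closed by auto
        ultimately show ?thesis unfolding M'_def using that(3) by blast
      qed
      have decompose: "\<exists>s n. a = s + mult n x \<and> s \<in> insert 0 M \<and> (a \<in> M \<or> 0 < n)"
        if "a \<in> M'" for a
      proof (cases "a \<in> M")
        case True
        then have "a = a + mult 0 x" by (simp add: mult_def)
        then show ?thesis using True by (metis insertI2)
      next
        case False
        then show ?thesis using that unfolding M'_def by blast
      qed
      obtain s n where s: "a = s + mult n x" "s \<in> insert 0 M" "a \<in> M \<or> 0 < n"
        using decompose[OF ab(1)] by blast
      obtain t m where t: "b = t + mult m x" "t \<in> insert 0 M" "b \<in> M \<or> 0 < m"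
        using decompose[OF ab(2)] by blast
      show ?thesis
      proof (cases "0 < n + m")
        case True
        then show ?thesis using *[OF s(2) t(2)] by (simp add: s(1) t(1))
      next
        case False
        then show ?thesis using s(3) t(3) M_closed by (auto simp: M'_def)
      qed
    qed
    moreover have "S \<subseteq> M'" using M unfolding \<A>_def M'_def by auto
    ultimately have "0 \<in> M'" unfolding \<A>_def by simp
    then obtain s n where sn: "s + mult n x = 0" "s \<in> insert 0 M" "0 < n"
      using M_zero unfolding M'_def by auto
    have "s \<noteq> 0" using torsion_free[of n x] sn that(1) by (auto simp: mult_def)
    then show ?thesis using sn by (metis add_eq_0_iff2 insertE)
  qed
  have "x \<in> M \<or> - x \<in> M" if "x \<noteq> 0" for x
  proof (rule ccontr)
    assume "\<not> ?thesis"
    then obtain m n where mn: "0 < m" "- mult m x \<in> M" "0 < n" "- mult n (- x) \<in> M"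
      using negative_multiple[of x] negative_multiple[of "- x"] \<open>x \<noteq> 0\<close> by auto
    (* Scaled to the common multiple m * n of x, the two elements of M are opposite. *)
    have "mult n (- mult m x) + mult m (- mult n (- x)) \<in> M"
      using mult_M mn M_closed by blast
    moreover have "mult n (- mult m x) + mult m (- mult n (- x)) = 0"
      by (simp add: mult_def sum_negf) (subst sum.swap, simp)
    ultimately show False using M_zero by simp
  qed
  then show thesis using that[of M] M M_closed M_zero unfolding \<A>_def by blast
qed

definition additive_group :: "'g::ab_group_add monoid" where
  "additive_group = \<lparr>carrier = UNIV, monoid.mult = (+), one = 0\<rparr>"

definition cone_order :: "'g::ab_group_add set \<Rightarrow> 'g rel" where
  "cone_order Q = {(x, y). x = y \<or> y - x \<in> Q}"

lemma additive_group_simps [simp]: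
  "carrier additive_group = UNIV" "x \<otimes>\<^bsub>additive_group\<^esub> y = x + y" "\<one>\<^bsub>additive_group\<^esub> = 0"
  by (simp_all add: additive_group_def)

lemma comm_group_additive_group: "comm_group additive_group"
  by (rule comm_groupI) (auto simp: algebra_simps intro: exI[of _ "- x" for x])

lemma inv_additive_group [simp]: "inv\<^bsub>additive_group\<^esub> x = - x"
proof -
  interpret comm_group "additive_group :: 'a monoid" by (rule comm_group_additive_group)
  show ?thesis by (rule inv_equality) simp_all
qed

lemma totally_ordered_cone_order:
  assumes "0 \<notin> Q" and closed: "\<And>x y. x \<in> Q \<Longrightarrow> y \<in> Q \<Longrightarrow> x + y \<in> Q"
    and total: "\<And>x. x \<noteq> 0 \<Longrightarrow> x \<in> Q \<or> - x \<in> Q"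
  shows "totally_ordered_abelian_group additive_group (cone_order Q)"
proof -
  interpret comm_group "additive_group :: 'a monoid" by (rule comm_group_additive_group)
  have "antisym (cone_order Q)"
  proof (rule antisymI)
    fix x y assume "(x, y) \<in> cone_order Q" "(y, x) \<in> cone_order Q"
    then show "x = y" using closed[of "y - x" "x - y"] assms(1) by (auto simp: cone_order_def)
  qed
  moreover have "trans (cone_order Q)"
  proof (rule transI)
    fix x y z assume "(x, y) \<in> cone_order Q" "(y, z) \<in> cone_order Q"
    then show "(x, z) \<in> cone_order Q"
      using closed[of "y - x" "z - y"] by (auto simp: cone_order_def)
  qed
  moreover have "total (cone_order Q)"
    using total[of "x - y" for x y] by (fastforce simp: total_on_def cone_order_def)
  ultimately have lin: "linear_order_on UNIV (cone_order Q)"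
    by (auto simp: order_on_defs refl_on_def cone_order_def)
  show ?thesis
    by unfold_locales (use lin in \<open>auto simp: order_on_defs cone_order_def\<close>)
qed


section \<open>Vanishing sums of weighted edges\<close>

text \<open>
  The coordinate \<open>Some x\<close> belongs to the point \<open>x\<close> and \<open>None\<close> to the threshold \<open>\<alpha>\<close>; the triple encodes the
  group element \<open>y - x + n \<alpha>\<close>, where points and threshold stand for their unit vectors.
\<close>

definition edge_vector :: "'a \<times> int \<times> 'a \<Rightarrow> 'a option \<Rightarrow> int" where
  "edge_vector = (\<lambda>(x, n, y) k. case k of None \<Rightarrow> n | Some v \<Rightarrow> of_bool (y = v) - of_bool (x = v))"

lemma edge_vector_compose:
  "edge_vector (x, m, y) + edge_vector (y, n, z) = edge_vector (x, m + n, z)"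
  by (auto simp: edge_vector_def fun_eq_iff split: option.split)

lemma sum_mset_fun_apply:
  "(\<Sum>e\<in>#M. f e) k = (\<Sum>e\<in>#M. f e k :: int)"
  by (induction M) auto

lemma sum_mset_nonneg:
  "(\<And>e. e \<in># M \<Longrightarrow> 0 \<le> f e) \<Longrightarrow> 0 \<le> (\<Sum>e\<in>#M. f e :: int)"
  by (induction M) auto

text \<open>
  Suppose a sum of edges vanishes, with as few summands as possible. An edge ending in \<open>v\<close> that is not a
  loop has coefficient \<open>1\<close> at \<open>v\<close>, so another summand starts in \<open>v\<close>, and merging the two edges gives a
  shorter vanishing sum. So all summands are loops, and then the coefficient of \<open>\<alpha>\<close> is positive.
\<close>

lemma edge_sum_nonzero:
  assumes compose: "\<And>m n. R m O R n \<subseteq> R (m + n)"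
    and loops: "\<And>x n. (x, x) \<in> R n \<Longrightarrow> 0 < n"
    and "M \<noteq> {#}" "\<And>x n y. (x, n, y) \<in># M \<Longrightarrow> (x, y) \<in> R n"
  shows "(\<Sum>e\<in>#M. edge_vector e) \<noteq> 0"
  using assms(3,4)
proof (induction "size M" arbitrary: M rule: less_induct)
  case less
  show ?case
  proof
    assume zero: "(\<Sum>e\<in>#M. edge_vector e) = 0"
    have zero_at: "(\<Sum>e\<in>#M. edge_vector e k) = 0" for k
      using fun_cong[OF zero, of k] by (simp add: sum_mset_fun_apply)
    show False
    proof (cases "\<exists>u n v. (u, n, v) \<in># M \<and> u \<noteq> v")
      case False
      have pos: "0 < edge_vector e None" if "e \<in># M" for e
      proof -
        obtain x n y where e: "e = (x, n, y)" by (cases e)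
        then have "x = y" "(x, y) \<in> R n" using that False less.prems(2) by auto
        then show ?thesis using loops by (simp add: e edge_vector_def)
      qed
      obtain e M' where M: "M = add_mset e M'" using less.prems(1) by (metis multiset_cases)
      have "0 \<le> (\<Sum>e\<in>#M'. edge_vector e None)"
        using pos unfolding M by (intro sum_mset_nonneg) (auto intro: less_imp_le)
      then show False using zero_at[of None] pos[of e] M by simp
    next
      case True
      then obtain u n v where uv: "(u, n, v) \<in># M" "u \<noteq> v" by blast
      define M' where "M' = M - {#(u, n, v)#}"
      have M: "M = add_mset (u, n, v) M'" using uv by (simp add: M'_def)
      have "1 + (\<Sum>e\<in>#M'. edge_vector e (Some v)) = 0"
        using zero_at[of "Some v"] uv(2) unfolding M by (simp add: edge_vector_def)
      moreover have "0 \<le> (\<Sum>e\<in>#M'. edge_vector e (Some v))"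
        if "\<forall>e\<in>#M'. 0 \<le> edge_vector e (Some v)"
        using that by (intro sum_mset_nonneg) auto
      ultimately obtain e where e: "e \<in># M'" "edge_vector e (Some v) < 0"
        by force
      then obtain m w where e_eq: "e = (v, m, w)"
        by (cases e) (auto simp: edge_vector_def of_bool_def split: if_splits)
      define M'' where "M'' = M' - {#e#}"
      have M': "M' = add_mset e M''" using e by (simp add: M''_def)
      have "(u, v) \<in> R n" "(v, w) \<in> R m"
        using less.prems(2) unfolding M M' e_eq by auto
      then have "(u, w) \<in> R (n + m)" using compose by blast
      moreover have "(\<Sum>e\<in>#add_mset (u, n + m, w) M''. edge_vector e) = 0"
        using zero unfolding M M' e_eq by (simp add: edge_vector_compose[of u n v m w, symmetric] add.assoc)
      ultimately show False
        using less.hyps[of "add_mset (u, n + m, w) M''"] less.prems(2) unfolding M M' by auto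
    qed
  qed
qed


section \<open>Representing a semiorder in an ordered group\<close>

text \<open>
  With \<open>A\<close> the relation \<open>x < y\<close>, the pairs \<open>(y, x)\<close> such that \<open>x < y\<close> fails form \<open>N\<close>. If \<open>y < x\<close> holds and
  \<open>z < x\<close> fails, then \<open>y\<close> precedes \<open>z\<close> in \<open>T\<close>, since otherwise \<open>A\<close> would absorb the step from \<open>z\<close> to \<open>y\<close>
  and give \<open>z < x\<close>. The diagonal of the whole type is included because its loops of weight \<open>1\<close> express the
  positivity of \<open>\<alpha>\<close>, which is needed for empty \<open>P\<close> as well.
\<close>

lemma complement_cancellation:
  fixes A T N :: "'a rel"
  assumes A_sub: "A \<subseteq> P \<times> P" and A_irrefl: "irrefl A"
    and T: "total_on P T" "T \<subseteq> P \<times> P" "A \<subseteq> T"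
    and AT: "A O T \<subseteq> A" and TA: "T O A \<subseteq> A"
    and N_def: "N = {(y, x). x \<in> P \<and> y \<in> P \<and> (x, y) \<notin> A} \<union> Id"
  shows "N O T \<subseteq> N" "T O N \<subseteq> N" "A O N \<subseteq> T" "N O A \<subseteq> T"
proof -
  have T_N: "T \<subseteq> N" using T TA A_irrefl unfolding N_def irrefl_def by blast
  have N_iff: "(y, x) \<in> N \<longleftrightarrow> y = x \<or> x \<in> P \<and> y \<in> P \<and> (x, y) \<notin> A" for x y
    unfolding N_def by blast
  have T_total: "(x, y) \<in> T" if "x \<in> P" "y \<in> P" "(y, x) \<notin> T" "x \<noteq> y" for x y
    using T(1) that unfolding total_on_def by blast
  have NT: "N O T \<subseteq> N"
  proof (intro subrelI)
    fix y z assume "(y, z) \<in> N O T"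
    then obtain x where yx: "(y, x) \<in> N" and xz: "(x, z) \<in> T" by blast
    have "(z, y) \<notin> A" if "(x, y) \<notin> A" using that xz TA by blast
    then show "(y, z) \<in> N" using yx xz T(2) T_N by (auto simp: N_iff)
  qed
  have TN: "T O N \<subseteq> N"
  proof (intro subrelI)
    fix y z assume "(y, z) \<in> T O N"
    then obtain x where yx: "(y, x) \<in> T" and xz: "(x, z) \<in> N" by blast
    have "(z, y) \<notin> A" if "(z, x) \<notin> A" using that yx AT by blast
    then show "(y, z) \<in> N" using yx xz T(2) T_N by (auto simp: N_iff)
  qed
  have AN: "A O N \<subseteq> T"
  proof (intro subrelI)
    fix y z assume "(y, z) \<in> A O N"
    then obtain x where yx: "(y, x) \<in> A" and xz: "(x, z) \<in> N" by blast
    have "(y, z) \<in> T" if "(z, x) \<notin> A" "z \<in> P"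
      using T_total[of y z] that yx TA A_sub by blast
    then show "(y, z) \<in> T" using yx xz T(3) by (auto simp: N_iff)
  qed
  have NA: "N O A \<subseteq> T"
  proof (intro subrelI)
    fix y z assume "(y, z) \<in> N O A"
    then obtain x where yx: "(y, x) \<in> N" and xz: "(x, z) \<in> A" by blast
    have "(y, z) \<in> T" if "(x, y) \<notin> A" "y \<in> P"
      using T_total[of y z] that xz AT A_sub by blast
    then show "(y, z) \<in> T" using yx xz T(3) by (auto simp: N_iff)
  qed
  show "N O T \<subseteq> N" "T O N \<subseteq> N" "A O N \<subseteq> T" "N O A \<subseteq> T"
    by (rule NT TN AN NA)+
qed

text \<open>
  The constraint graph of a semiorder has no closed walk of weight at most \<open>0\<close>, so the group elements that a
  representation by unit vectors should make positive generate a semigroup without \<open>0\<close>, which extends to the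
  positive cone of a total order on the group.
\<close>

lemma semiorder_positive_cone:
  fixes P :: "'a set"
  assumes exchange: "semiorder_exchange P A" and A_sub: "A \<subseteq> P \<times> P" and A_irrefl: "irrefl A"
  obtains Q where "0 \<notin> Q" "\<And>u v. u \<in> Q \<Longrightarrow> v \<in> Q \<Longrightarrow> u + v \<in> Q" "\<And>u. u \<noteq> 0 \<Longrightarrow> u \<in> Q \<or> - u \<in> Q"
    "\<And>x y. (x, y) \<in> A \<Longrightarrow> edge_vector (x, - 1, y) \<in> Q"
    "\<And>x y. x \<in> P \<Longrightarrow> y \<in> P \<Longrightarrow> (x, y) \<notin> A \<Longrightarrow> edge_vector (y, 1, x) \<in> Q"
    "\<And>x. edge_vector (x, 1, x) \<in> Q"
proof -
  obtain T where T: "trans T" "irrefl T" "total_on P T" "T \<subseteq> P \<times> P" "A \<subseteq> T"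
    and AT: "A O T \<subseteq> A" and TA: "T O A \<subseteq> A"
    using linear_refinement[OF exchange A_sub A_irrefl] by metis
  define N :: "'a rel" where "N = {(y, x). x \<in> P \<and> y \<in> P \<and> (x, y) \<notin> A} \<union> Id"
  note compose = weighted_walk_compose[OF AT TA
      complement_cancellation[OF A_sub A_irrefl T(3-5) AT TA N_def] T(1)]
  define R where "R = weighted_walk A N T"
  define S where "S = {\<Sum>e\<in>#M. edge_vector e | M.
    M \<noteq> {#} \<and> (\<forall>x n y. (x, n, y) \<in># M \<longrightarrow> (x, y) \<in> R n)}"
  have "0 \<notin> S"
    using edge_sum_nonzero[of R] compose weighted_walk_loop[OF T(5,1,2)]
    unfolding S_def R_def by fastforce
  moreover have "a + b \<in> S" if ab: "a \<in> S" "b \<in> S" for a b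
  proof -
    obtain M M' where "a = (\<Sum>e\<in>#M. edge_vector e)" "b = (\<Sum>e\<in>#M'. edge_vector e)"
      "M \<noteq> {#}" "\<forall>x n y. (x, n, y) \<in># M \<longrightarrow> (x, y) \<in> R n"
      "\<forall>x n y. (x, n, y) \<in># M' \<longrightarrow> (x, y) \<in> R n"
      using ab unfolding S_def by blast
    then show ?thesis unfolding S_def by (intro CollectI exI[of _ "M + M'"]) auto
  qed
  moreover have "x = 0" if "0 < n" "(\<Sum>i<n. x) = 0" for n :: nat and x :: "'a rep_universe"
  proof
    fix k
    show "x k = 0 k" using fun_cong[OF that(2), of k] that(1) by simp
  qed
  ultimately obtain Q where Q: "S \<subseteq> Q" "0 \<notin> Q" "\<And>x y. x \<in> Q \<Longrightarrow> y \<in> Q \<Longrightarrow> x + y \<in> Q"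
    "\<And>x. x \<noteq> 0 \<Longrightarrow> x \<in> Q \<or> - x \<in> Q"
    using extend_to_total_cone[of S] by metis
  have edge: "edge_vector (x, n, y) \<in> Q" if "(x, y) \<in> R n" for x n y
  proof -
    have "edge_vector (x, n, y) \<in> S"
      unfolding S_def using that by (intro CollectI exI[of _ "{#(x, n, y)#}"]) auto
    then show ?thesis using Q(1) by blast
  qed
  show thesis
  proof
    show "edge_vector (x, - 1, y) \<in> Q" if "(x, y) \<in> A" for x y
      by (rule edge) (use that in \<open>simp add: R_def weighted_walk_def\<close>)
    show "edge_vector (y, 1, x) \<in> Q" if "x \<in> P" "y \<in> P" "(x, y) \<notin> A" for x y
      by (rule edge) (use that in \<open>simp add: R_def weighted_walk_def N_def\<close>)
    show "edge_vector (x, 1, x) \<in> Q" for x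
      by (rule edge) (simp add: R_def weighted_walk_def N_def)
  qed (fact Q)+
qed

text \<open>
  The elements of \<open>P\<close> go to their unit vectors. The positive cone places \<open>y - x\<close> strictly above \<open>\<alpha>\<close> if
  \<open>x < y\<close> and strictly below it otherwise.
\<close>

lemma semiorder_imp_attained_threshold:
  fixes P :: "'a set"
  assumes po: "partial_order_on P r" and semi: "semiorder_on P r"
  shows "embeds_in_attained_threshold_group TYPE('a rep_universe) P r"
proof -
  define A where "A = r - Id"
  have A_sub: "A \<subseteq> P \<times> P" and r_iff: "\<And>x y. x \<in> P \<Longrightarrow> (x, y) \<in> r \<longleftrightarrow> x = y \<or> (x, y) \<in> A"
    and A_irrefl: "irrefl A"
    using po by (auto simp: A_def order_on_defs refl_on_def irrefl_def)
  have exchange: "semiorder_exchange P A"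
    using semi semiorder_on_iff_exchange[OF po] by (simp add: A_def)
  obtain Q where Q: "0 \<notin> Q" "\<And>u v. u \<in> Q \<Longrightarrow> v \<in> Q \<Longrightarrow> u + v \<in> Q"
      "\<And>u. u \<noteq> 0 \<Longrightarrow> u \<in> Q \<or> - u \<in> Q"
    and forward: "\<And>x y. (x, y) \<in> A \<Longrightarrow> edge_vector (x, - 1, y) \<in> Q"
    and backward: "\<And>x y. x \<in> P \<Longrightarrow> y \<in> P \<Longrightarrow> (x, y) \<notin> A \<Longrightarrow> edge_vector (y, 1, x) \<in> Q"
    and loop: "\<And>x. edge_vector (x, 1, x) \<in> Q"
    using semiorder_positive_cone[OF exchange A_sub A_irrefl] by blast
  define \<alpha> :: "'a rep_universe" where "\<alpha> = (\<lambda>k. of_bool (k = None))"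
  define f :: "'a \<Rightarrow> 'a rep_universe" where "f x = (\<lambda>k. of_bool (k = Some x))" for x
  have edge_eq: "edge_vector (x, n, y) = f y - f x + (\<lambda>k. n) * \<alpha>" for x n y
    by (auto simp: fun_eq_iff edge_vector_def f_def \<alpha>_def split: option.split)
  have "\<alpha> = edge_vector (x, 1, x)" for x
    by (auto simp: edge_eq fun_eq_iff)
  then have "\<alpha> \<in> Q" using loop by metis
  have f_inj: "x = y" if "f x = f y" for x y
    using fun_cong[OF that, of "Some x"] by (simp add: f_def split: if_splits)
  have embeds: "f y - f x = \<alpha> \<or> f y - f x - \<alpha> \<in> Q \<longleftrightarrow> (x, y) \<in> A" if "x \<in> P" "y \<in> P" for x y
  proof
    assume "(x, y) \<in> A"
    then have "edge_vector (x, - 1, y) \<in> Q" by (rule forward)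
    moreover have "edge_vector (x, - 1, y) = f y - f x - \<alpha>" by (simp add: edge_eq fun_eq_iff)
    ultimately show "f y - f x = \<alpha> \<or> f y - f x - \<alpha> \<in> Q" by simp
  next
    assume far: "f y - f x = \<alpha> \<or> f y - f x - \<alpha> \<in> Q"
    show "(x, y) \<in> A"
    proof (rule ccontr)
      assume "(x, y) \<notin> A"
      then have "edge_vector (y, 1, x) \<in> Q" using that by (intro backward)
      moreover have "edge_vector (y, 1, x) = - (f y - f x - \<alpha>)" by (simp add: edge_eq fun_eq_iff)
      ultimately have near: "- (f y - f x - \<alpha>) \<in> Q" by simp
      from far show False
      proof
        assume "f y - f x = \<alpha>"
        then show False using near Q(1) by simp
      next
        assume "f y - f x - \<alpha> \<in> Q"
        from Q(2)[OF this near] show False using Q(1) by simp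
      qed
    qed
  qed
  have "totally_ordered_abelian_group additive_group (cone_order Q)"
    using totally_ordered_cone_order[OF Q] .
  moreover have "positive_in additive_group (cone_order Q) \<alpha>"
    using \<open>\<alpha> \<in> Q\<close> Q(1) by (auto simp: positive_in_def cone_order_def)
  moreover have "poset_embedding P r (carrier additive_group)
      (threshold_rel additive_group (cone_order Q) \<alpha>) f"
    using f_inj embeds r_iff
    by (auto simp: poset_embedding_def inj_on_def threshold_rel_def cone_order_def)
  ultimately show ?thesis
    unfolding embeds_in_attained_threshold_group_def abelian_threshold_group_attained_def
      poset_embeds_def by blast
qed

theorem theorem7:
  fixes P :: "'a set" and r :: "'a rel"
  assumes "partial_order_on P r"
  shows
    "(semiorder_on P r \<longleftrightarrow> rep_by_incomparable_intervals TYPE('a rep_universe) P r) \<and>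
     (semiorder_on P r \<longleftrightarrow> rep_by_group_intervals TYPE('a rep_universe) P r) \<and>
     (semiorder_on P r \<longleftrightarrow> embeds_in_attained_threshold_group TYPE('a rep_universe) P r) \<and>
     (semiorder_on P r \<longleftrightarrow> embeds_in_threshold_group TYPE('a rep_universe) P r) \<and>
     (rep_by_incomparable_intervals TYPE('b) P r \<longrightarrow> semiorder_on P r) \<and>
     (rep_by_group_intervals TYPE('c) P r \<longrightarrow> semiorder_on P r) \<and>
     (embeds_in_attained_threshold_group TYPE('d) P r \<longrightarrow> semiorder_on P r) \<and>
     (embeds_in_threshold_group TYPE('e) P r \<longrightarrow> semiorder_on P r)"
proof -
  note to_attained = semiorder_imp_attained_threshold[OF assms]
  note to_threshold = attained_threshold_imp_threshold[OF to_attained]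
    and to_group = attained_threshold_imp_group_intervals[OF to_attained]
  note to_intervals = group_intervals_imp_incomparable_intervals[OF to_group]
  note from_intervals = incomparable_intervals_imp_semiorder[OF assms]
    and from_threshold = threshold_imp_semiorder[OF assms]
  note from_group = from_intervals[OF group_intervals_imp_incomparable_intervals]
    and from_attained = from_threshold[OF attained_threshold_imp_threshold]
  show ?thesis
    by (intro conjI iffI impI)
      (erule to_attained to_threshold to_group to_intervals
        from_attained from_threshold from_group from_intervals)+
qed

end
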